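(* Let $S$ be a left cancellative semigroup. There is a faithful representation $\omega:I_l(S)\to B(\ell^2(S))$ (an injective semigroup homomorphism into partial isometries) such that $\omega(\lambda_s)=V_s$ for each $s\in S$. So $\omega$ is an isomorphism of $I_l(S)$ onto $V(S)$.
   Context: A semigroup means a set with associative product and identity element $1$ (a monoid). $S$ is left cancellative if $sr=st$ implies $r=t$. For $s\in S$, $\lambda_s:S\to sS$, $\lambda_s(t)=st$, is a bijection. $I(S)$ is the inverse semigroup of all partially defined bijections $f:\mathrm{dom}(f)\to\mathrm{ran}(f)$ with $\mathrm{dom}(f),\mathrm{ran}(f)\subset S$, with composition $fg$ defined on $\mathrm{dom}(fg)=g^{-1}(\mathrm{dom}(f))$ and $f^*$ the inverse partial map; the empty map acts as zero. $I_l(S)$ (the left inverse hull of $S$) is the inverse subsemigroup of $I(S)$ generated by $\{\lambda_s\}_{s\in S}$. $\{\varepsilon_s\}_{s\in S}$ is the canonical orthonormal basis of $\ell^2(S)$, and $V_s\in B(\ell^2(S))$ is the isometry $V_s\varepsilon_t=\varepsilon_{st}$. $V(S)=\{V_{t_1}^*V_{s_1}\cdots V_{t_n}^*V_{s_n}:n\in\mathbb{N},\ s_i,t_i\in S\}$, which is an inverse semigroup of partial isometries under composition, with involution the operator adjoint. *)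

theory Defs
  imports "HOL-Analysis.Analysis" "HOL-Algebra.Group"
begin

section \<open>The Hilbert space of square-summable functions\<close>

typedef 'a ell2 = "{f :: 'a \<Rightarrow> complex. (\<lambda>s. (cmod (f s))\<^sup>2) summable_on UNIV}"
  morphisms ell2_fun Abs_ell2
  by (rule exI[of _ "\<lambda>_. 0"]) simp

setup_lifting type_definition_ell2

lemma ell2_summable: "(\<lambda>s. (cmod (ell2_fun x s))\<^sup>2) summable_on UNIV"
  using ell2_fun[of x] by simp

lemma summable_add_sq:
  fixes f g :: "'a \<Rightarrow> complex"
  assumes "(\<lambda>s. (cmod (f s))\<^sup>2) summable_on UNIV" "(\<lambda>s. (cmod (g s))\<^sup>2) summable_on UNIV"
  shows "(\<lambda>s. (cmod (f s + g s))\<^sup>2) summable_on UNIV"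
proof (rule summable_on_comparison_test)
  show "(\<lambda>s. 2 * ((cmod (f s))\<^sup>2 + (cmod (g s))\<^sup>2)) summable_on UNIV"
    by (intro summable_on_cmult_right summable_on_add assms)
  fix s
  have "(cmod (f s + g s))\<^sup>2 \<le> (cmod (f s) + cmod (g s))\<^sup>2"
    by (intro power_mono norm_triangle_ineq) auto
  also have "\<dots> \<le> 2 * ((cmod (f s))\<^sup>2 + (cmod (g s))\<^sup>2)"
    using sum_squares_bound[of "cmod (f s)" "cmod (g s)"] by (simp add: power2_sum)
  finally show "(cmod (f s + g s))\<^sup>2 \<le> 2 * ((cmod (f s))\<^sup>2 + (cmod (g s))\<^sup>2)" .
qed auto

lemma summable_mult_cnj:
  fixes f g :: "'a \<Rightarrow> complex"
  assumes "(\<lambda>s. (cmod (f s))\<^sup>2) summable_on UNIV" "(\<lambda>s. (cmod (g s))\<^sup>2) summable_on UNIV"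
  shows "(\<lambda>s. f s * cnj (g s)) summable_on UNIV"
proof (rule abs_summable_summable, rule summable_on_comparison_test)
  show "(\<lambda>s. (cmod (f s))\<^sup>2 + (cmod (g s))\<^sup>2) summable_on UNIV"
    by (intro summable_on_add assms)
  fix s
  have "2 * (cmod (f s) * cmod (g s)) \<le> (cmod (f s))\<^sup>2 + (cmod (g s))\<^sup>2"
    using sum_squares_bound[of "cmod (f s)" "cmod (g s)"] by (simp add: mult.assoc)
  moreover have "0 \<le> cmod (f s) * cmod (g s)" by simp
  ultimately show "norm (f s * cnj (g s)) \<le> (cmod (f s))\<^sup>2 + (cmod (g s))\<^sup>2"
    unfolding norm_mult complex_mod_cnj by linarith
qed auto

lift_definition scaleC_ell2 :: "complex \<Rightarrow> 'a ell2 \<Rightarrow> 'a ell2" is "\<lambda>c f s. c * f s"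
  by (simp add: norm_mult power_mult_distrib summable_on_cmult_right)

lift_definition cinner_ell2 :: "'a ell2 \<Rightarrow> 'a ell2 \<Rightarrow> complex" is
  "\<lambda>f g. \<Sum>\<^sub>\<infinity>s. f s * cnj (g s)" .

lift_definition ket :: "'a \<Rightarrow> 'a ell2" is "\<lambda>s t. if t = s then 1 else 0"
proof -
  fix s :: 'a
  have "(\<lambda>t. (cmod (if t = s then 1 else 0))\<^sup>2) summable_on {s}"
    by simp
  then show "(\<lambda>t. (cmod (if t = s then 1 else 0))\<^sup>2) summable_on UNIV"
    by (rule summable_on_cong_neutral[THEN iffD1, rotated -1]) auto
qed

text \<open>The real inner product structure is the underlying real one of \<^const>\<open>cinner_ell2\<close>;
  it supplies the norm and the topology.\<close>

instantiation ell2 :: (type) real_vector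
begin
lift_definition zero_ell2 :: "'a ell2" is "\<lambda>_. 0" by simp
lift_definition plus_ell2 :: "'a ell2 \<Rightarrow> 'a ell2 \<Rightarrow> 'a ell2" is "\<lambda>f g s. f s + g s"
  by (rule summable_add_sq)
lift_definition uminus_ell2 :: "'a ell2 \<Rightarrow> 'a ell2" is "\<lambda>f s. - f s" by simp
lift_definition minus_ell2 :: "'a ell2 \<Rightarrow> 'a ell2 \<Rightarrow> 'a ell2" is "\<lambda>f g s. f s - g s"
  subgoal for f g using summable_add_sq[of f "\<lambda>s. - g s"] by simp
  done
definition scaleR_ell2 :: "real \<Rightarrow> 'a ell2 \<Rightarrow> 'a ell2" where
  "scaleR_ell2 r = scaleC_ell2 (complex_of_real r)"
instance
  by standard
    (simp_all add: ell2_fun_inject[symmetric] fun_eq_iff scaleR_ell2_def scaleC_ell2.rep_eq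
      zero_ell2.rep_eq plus_ell2.rep_eq uminus_ell2.rep_eq minus_ell2.rep_eq
      distrib_left distrib_right)
end

instantiation ell2 :: (type) real_inner
begin
definition inner_ell2 :: "'a ell2 \<Rightarrow> 'a ell2 \<Rightarrow> real" where
  "inner_ell2 x y = Re (cinner_ell2 x y)"
definition norm_ell2 :: "'a ell2 \<Rightarrow> real" where
  "norm_ell2 x = sqrt (inner x x)"
definition dist_ell2 :: "'a ell2 \<Rightarrow> 'a ell2 \<Rightarrow> real" where
  "dist_ell2 x y = norm (x - y)"
definition sgn_ell2 :: "'a ell2 \<Rightarrow> 'a ell2" where
  "sgn_ell2 x = x /\<^sub>R norm x"
definition uniformity_ell2 :: "('a ell2 \<times> 'a ell2) filter" where
  "uniformity_ell2 = (INF e\<in>{0<..}. principal {(x, y). dist x y < e})"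
definition open_ell2 :: "'a ell2 set \<Rightarrow> bool" where
  "open_ell2 U \<longleftrightarrow> (\<forall>x\<in>U. \<forall>\<^sub>F (x', y) in uniformity. x' = x \<longrightarrow> y \<in> U)"

instance
proof
  fix x y z :: "'a ell2" and r :: real and U :: "'a ell2 set"
  show "dist x y = norm (x - y)" by (rule dist_ell2_def)
  show "sgn x = x /\<^sub>R norm x" by (rule sgn_ell2_def)
  show "uniformity = (INF e\<in>{0<..}. principal {(x :: 'a ell2, y). dist x y < e})"
    by (rule uniformity_ell2_def)
  show "open U = (\<forall>x\<in>U. \<forall>\<^sub>F (x', y) in uniformity. x' = x \<longrightarrow> y \<in> U)"
    by (rule open_ell2_def)
  show "norm x = sqrt (inner x x)" by (rule norm_ell2_def)
  have "cinner_ell2 y x = cnj (cinner_ell2 x y)"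
    by transfer (simp add: infsum_cnj[symmetric] mult.commute del: infsum_cnj)
  then show "inner x y = inner y x" by (simp add: inner_ell2_def)
  have "cinner_ell2 (x + y) z = cinner_ell2 x z + cinner_ell2 y z"
    by transfer (simp add: distrib_right infsum_add summable_mult_cnj)
  then show "inner (x + y) z = inner x z + inner y z" by (simp add: inner_ell2_def)
  have "cinner_ell2 (r *\<^sub>R x) y = complex_of_real r * cinner_ell2 x y"
    unfolding scaleR_ell2_def
    by transfer (simp add: mult.assoc infsum_cmult_right')
  then show "inner (r *\<^sub>R x) y = r * inner x y" by (simp add: inner_ell2_def)
  have eq: "inner x x = (\<Sum>\<^sub>\<infinity>s. (cmod (ell2_fun x s))\<^sup>2)"
  proof -
    have "cinner_ell2 x x = (\<Sum>\<^sub>\<infinity>s. complex_of_real ((cmod (ell2_fun x s))\<^sup>2))"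
      unfolding cinner_ell2.rep_eq by (simp only: complex_norm_square)
    also have "\<dots> = complex_of_real (\<Sum>\<^sub>\<infinity>s. (cmod (ell2_fun x s))\<^sup>2)"
      by (intro infsumI has_sum_of_real has_sum_infsum ell2_summable)
    finally show ?thesis by (simp add: inner_ell2_def)
  qed
  show "0 \<le> inner x x" unfolding eq by (rule infsum_nonneg) simp
  have "x = 0" if "inner x x = 0"
  proof -
    have "(cmod (ell2_fun x s))\<^sup>2 = 0" for s
      by (rule nonneg_infsum_le_0D[of "\<lambda>s. (cmod (ell2_fun x s))\<^sup>2" UNIV])
        (use that eq ell2_summable in auto)
    then show "x = 0" by (auto simp: ell2_fun_inject[symmetric] zero_ell2.rep_eq)
  qed
  moreover have "inner x x = 0" if "x = 0"
    unfolding eq using that by (simp add: zero_ell2.rep_eq)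
  ultimately show "inner x x = 0 \<longleftrightarrow> x = 0" by blast
qed
end

lemma norm_ell2_eq: "(norm (x :: 'a ell2))\<^sup>2 = (\<Sum>\<^sub>\<infinity>s. (cmod (ell2_fun x s))\<^sup>2)"
proof -
  have "cinner_ell2 x x = (\<Sum>\<^sub>\<infinity>s. complex_of_real ((cmod (ell2_fun x s))\<^sup>2))"
    unfolding cinner_ell2.rep_eq by (simp only: complex_norm_square)
  also have "\<dots> = complex_of_real (\<Sum>\<^sub>\<infinity>s. (cmod (ell2_fun x s))\<^sup>2)"
    by (intro infsumI has_sum_of_real has_sum_infsum ell2_summable)
  finally show ?thesis by (simp add: power2_norm_eq_inner inner_ell2_def)
qed


section \<open>Bounded operators\<close>

definition bounded_clinear_ell2 :: "('a ell2 \<Rightarrow> 'a ell2) \<Rightarrow> bool" where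
  "bounded_clinear_ell2 T \<longleftrightarrow>
     bounded_linear T \<and> (\<forall>c x. T (scaleC_ell2 c x) = scaleC_ell2 c (T x))"

definition adj :: "('a ell2 \<Rightarrow> 'a ell2) \<Rightarrow> 'a ell2 \<Rightarrow> 'a ell2" where
  "adj T = (THE T'. bounded_clinear_ell2 T' \<and>
                    (\<forall>x y. cinner_ell2 (T x) y = cinner_ell2 x (T' y)))"

definition partial_isometry :: "('a ell2 \<Rightarrow> 'a ell2) \<Rightarrow> bool" where
  "partial_isometry T \<longleftrightarrow> bounded_clinear_ell2 T \<and>
     (\<forall>x. (\<forall>y. T y = 0 \<longrightarrow> cinner_ell2 x y = 0) \<longrightarrow> norm (T x) = norm x)"

definition operator_monoid :: "('a ell2 \<Rightarrow> 'a ell2) set \<Rightarrow> ('a ell2 \<Rightarrow> 'a ell2) monoid" where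
  "operator_monoid A = \<lparr>carrier = A, mult = (\<circ>), one = id\<rparr>"

abbreviation B_ell2 :: "('a ell2 \<Rightarrow> 'a ell2) monoid" where
  "B_ell2 \<equiv> operator_monoid {T. bounded_clinear_ell2 T}"


section \<open>The left inverse hull\<close>

text \<open>Partial maps are composed by \<^const>\<open>map_comp\<close>, whose domain
  \<open>dom (f \<circ>\<^sub>m g)\<close> is the preimage of \<open>dom f\<close> under \<open>g\<close>.\<close>

definition pinv :: "('a \<rightharpoonup> 'a) \<Rightarrow> ('a \<rightharpoonup> 'a)" where
  "pinv f = (\<lambda>y. if y \<in> ran f then Some (THE x. f x = Some y) else None)"

definition left_mult :: "'a::monoid_mult \<Rightarrow> ('a \<rightharpoonup> 'a)" where
  "left_mult s = (\<lambda>t. Some (s * t))"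

inductive_set left_inverse_hull :: "('a::monoid_mult \<rightharpoonup> 'a) set" where
  gen: "left_mult s \<in> left_inverse_hull"
| comp: "f \<in> left_inverse_hull \<Longrightarrow> g \<in> left_inverse_hull \<Longrightarrow> f \<circ>\<^sub>m g \<in> left_inverse_hull"
| inv: "f \<in> left_inverse_hull \<Longrightarrow> pinv f \<in> left_inverse_hull"

definition Il :: "('a::monoid_mult \<rightharpoonup> 'a) monoid" where
  "Il = \<lparr>carrier = left_inverse_hull, mult = (\<circ>\<^sub>m), one = Some\<rparr>"


section \<open>The semigroup generated by the isometries\<close>

definition V :: "'a::monoid_mult \<Rightarrow> 'a ell2 \<Rightarrow> 'a ell2" where
  "V s = (THE T. bounded_clinear_ell2 T \<and> (\<forall>t. T (ket t) = ket (s * t)))"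

definition V_words :: "('a::monoid_mult ell2 \<Rightarrow> 'a ell2) set" where
  "V_words = {foldr (\<lambda>(t, s) A. adj (V t) \<circ> V s \<circ> A) w id | w :: ('a \<times> 'a) list. w \<noteq> []}"

abbreviation VS :: "('a::monoid_mult ell2 \<Rightarrow> 'a ell2) monoid" where
  "VS \<equiv> operator_monoid V_words"


section \<open>Well-definedness of the isometries\<close>

lemma has_sum_ket:
  fixes x :: "'a ell2"
  shows "((\<lambda>s. scaleC_ell2 (ell2_fun x s) (ket s)) has_sum x) UNIV"
proof -
  let ?g = "\<lambda>s. (cmod (ell2_fun x s))\<^sup>2"
  let ?S = "\<lambda>F. \<Sum>s\<in>F. scaleC_ell2 (ell2_fun x s) (ket s)"
  have S: "ell2_fun (?S F) t = (if t \<in> F then ell2_fun x t else 0)" if "finite F" for F t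
    using that
    by (induction F rule: finite_induct)
      (auto simp: zero_ell2.rep_eq plus_ell2.rep_eq scaleC_ell2.rep_eq ket.rep_eq)
  have N: "(norm (?S F - x))\<^sup>2 = infsum ?g UNIV - sum ?g F" if F: "finite F" for F
  proof -
    have "(norm (?S F - x))\<^sup>2 = (\<Sum>\<^sub>\<infinity>t. if t \<in> F then 0 else ?g t)"
      unfolding norm_ell2_eq by (rule infsum_cong) (simp add: minus_ell2.rep_eq S F)
    also have "\<dots> = infsum ?g (UNIV - F)"
      by (rule infsum_cong_neutral) auto
    also have "\<dots> = infsum ?g UNIV - infsum ?g F"
      by (rule infsum_Diff) (use F ell2_summable in auto)
    finally show ?thesis using F by simp
  qed
  have "(?g has_sum infsum ?g UNIV) UNIV"
    using ell2_summable by (rule has_sum_infsum)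
  then have lim: "(sum ?g \<longlongrightarrow> infsum ?g UNIV) (finite_subsets_at_top UNIV)"
    by (simp add: has_sum_def)
  have "((\<lambda>F. sqrt (infsum ?g UNIV - sum ?g F)) \<longlongrightarrow> 0) (finite_subsets_at_top UNIV)"
    using tendsto_real_sqrt[OF tendsto_diff[OF tendsto_const lim], of "infsum ?g UNIV"] by simp
  moreover have "\<forall>\<^sub>F F in finite_subsets_at_top UNIV.
      sqrt (infsum ?g UNIV - sum ?g F) = norm (?S F - x)"
    by (rule eventually_finite_subsets_at_top_weakI) (simp add: N[symmetric])
  ultimately have "((\<lambda>F. norm (?S F - x)) \<longlongrightarrow> 0) (finite_subsets_at_top UNIV)"
    by (rule Lim_transform_eventually)
  then have "((\<lambda>F. ?S F - x) \<longlongrightarrow> 0) (finite_subsets_at_top UNIV)"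
    by (rule tendsto_norm_zero_cancel)
  then have "(?S \<longlongrightarrow> x) (finite_subsets_at_top UNIV)"
    by (rule LIM_zero_cancel)
  then show ?thesis
    by (simp add: has_sum_def)
qed

lemma bounded_clinear_ell2_ext:
  fixes A B :: "'a ell2 \<Rightarrow> 'a ell2"
  assumes A: "bounded_clinear_ell2 A" and B: "bounded_clinear_ell2 B"
    and eq: "\<And>t. A (ket t) = B (ket t)"
  shows "A = B"
proof
  fix x :: "'a ell2"
  have lin: "((\<lambda>s. scaleC_ell2 (ell2_fun x s) (T (ket s))) has_sum T x) UNIV"
    if T: "bounded_clinear_ell2 T" for T :: "'a ell2 \<Rightarrow> 'a ell2"
  proof -
    have "bounded_linear T" and sc: "\<And>c y. T (scaleC_ell2 c y) = scaleC_ell2 c (T y)"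
      using T by (auto simp: bounded_clinear_ell2_def)
    from has_sum_bounded_linear[OF this(1) has_sum_ket[of x]]
    show ?thesis by (simp only: sc o_def)
  qed
  have "((\<lambda>s. scaleC_ell2 (ell2_fun x s) (B (ket s))) has_sum A x) UNIV"
    using lin[OF A] by (simp only: eq)
  then show "A x = B x"
    using lin[OF B] by (rule has_sum_unique)
qed

lemma V_unique_existence:
  fixes s :: "'a::monoid_mult"
  assumes canc: "\<And>s r t :: 'a. s * r = s * t \<Longrightarrow> r = t"
  shows "\<exists>!T. bounded_clinear_ell2 T \<and> (\<forall>t. T (ket t) = ket (s * t))"
proof (rule ex_ex1I)
  have inj: "inj ((*) s)" using canc by (auto intro: injI)
  define h where "h f = (\<lambda>r. if r \<in> range ((*) s) then f (inv_into UNIV ((*) s) r) else 0)"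
    for f :: "'a \<Rightarrow> complex"
  have h: "h f (s * t) = f t" for f t using inj by (simp add: h_def)
  have h0: "h f r = 0" if "r \<notin> range ((*) s)" for f r using that by (simp add: h_def)
  have has: "((\<lambda>r. (cmod (h (ell2_fun x) r))\<^sup>2) has_sum (norm x)\<^sup>2) UNIV" for x
  proof -
    have "((\<lambda>r. (cmod (h (ell2_fun x) r))\<^sup>2) \<circ> (*) s has_sum (norm x)\<^sup>2) UNIV"
      unfolding norm_ell2_eq using has_sum_infsum[OF ell2_summable[of x]] by (simp add: o_def h)
    then have "((\<lambda>r. (cmod (h (ell2_fun x) r))\<^sup>2) has_sum (norm x)\<^sup>2) (range ((*) s))"
      by (simp only: has_sum_reindex[OF inj])
    then show ?thesis
      by (rule has_sum_cong_neutral[THEN iffD1, rotated -1]) (auto simp: h0)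
  qed
  define T where "T x = Abs_ell2 (h (ell2_fun x))" for x
  have T: "ell2_fun (T x) = h (ell2_fun x)" for x
    unfolding T_def
    by (rule Abs_ell2_inverse) (simp only: mem_Collect_eq has_sum_imp_summable[OF has])
  have nT: "norm (T x) = norm x" for x
  proof -
    have "(norm (T x))\<^sup>2 = (norm x)\<^sup>2"
      unfolding norm_ell2_eq[of "T x"] T by (rule infsumI[OF has])
    then show ?thesis by simp
  qed
  have add: "T (x + y) = T x + T y" for x y
    by (auto simp: ell2_fun_inject[symmetric] T plus_ell2.rep_eq h_def)
  have sc: "T (scaleC_ell2 c x) = scaleC_ell2 c (T x)" for c x
    by (auto simp: ell2_fun_inject[symmetric] T scaleC_ell2.rep_eq h_def)
  have "bounded_linear T"
    by (rule bounded_linear_intro[where K = 1]) (simp_all add: add sc nT scaleR_ell2_def)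
  moreover have "T (ket t) = ket (s * t)" for t
  proof -
    have "h (ell2_fun (ket t)) r = ell2_fun (ket (s * t)) r" for r
      by (cases "r \<in> range ((*) s)") (auto simp: h h0 ket.rep_eq dest: canc)
    then show ?thesis by (auto simp: ell2_fun_inject[symmetric] T)
  qed
  ultimately show "\<exists>T. bounded_clinear_ell2 T \<and> (\<forall>t. T (ket t) = ket (s * t))"
    using sc unfolding bounded_clinear_ell2_def by (intro exI[of _ T]) auto
next
  fix A B :: "'a ell2 \<Rightarrow> 'a ell2"
  assume "bounded_clinear_ell2 A \<and> (\<forall>t. A (ket t) = ket (s * t))"
    and "bounded_clinear_ell2 B \<and> (\<forall>t. B (ket t) = ket (s * t))"
  then show "A = B" by (intro bounded_clinear_ell2_ext) auto
qed

end

theory Submission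
  imports Defs
begin

text \<open>A partial injection \<open>g\<close> acts on \<open>\<ell>\<^sup>2\<close> by \<open>x \<mapsto> x \<circ> g\<close>, extended by zero outside \<open>dom g\<close>. This action
  reverses composition, turns \<^const>\<open>pinv\<close> into the adjoint, and determines \<open>g\<close> through its values on
  the basis, so \<open>\<omega> f\<close> is the action of \<open>pinv f\<close>. Its range is found inside the inverse hull:
  the products of maps \<open>pinv \<lambda>\<^sub>t \<circ> \<lambda>\<^sub>s\<close> contain \<open>\<lambda>\<^sub>s\<close> (take \<open>t = 1\<close>) and are closed under composition
  and inversion, hence they exhaust the hull.\<close>

section \<open>Partial injections\<close>

text \<open>Injectivity makes the definite description in \<open>pinv\<close> pick the only
  preimage. All graph-level reasoning about \<open>pinv\<close> below rests on this
  equivalence.\<close>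

lemma pinv_eq_Some_iff:
  assumes "inj_on f (dom f)"
  shows "pinv f y = Some x \<longleftrightarrow> f x = Some y"
proof -
  have uniq: "(THE x. f x = Some y) = x" if "f x = Some y" for x
    using that assms by (intro the_equality) (auto simp: inj_on_def dom_def)
  show ?thesis
    unfolding pinv_def using uniq by (auto simp: ran_def)
qed

text \<open>A partial map is determined by its graph. In this form, equalities of partial maps
  reduce to \<open>pinv_eq_Some_iff\<close> and \<open>map_comp_Some_iff\<close>.\<close>

lemma partial_map_eqI:
  assumes "\<And>x y. f x = Some y \<longleftrightarrow> g x = Some y"
  shows "f = g"
  by (rule ext) (metis assms option.exhaust)

lemma inj_on_dom_pinv:
  assumes "inj_on f (dom f)"
  shows "inj_on (pinv f) (dom (pinv f))"
  using pinv_eq_Some_iff[OF assms] by (intro inj_onI) (metis domD option.inject)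

lemma pinv_pinv:
  assumes "inj_on f (dom f)"
  shows "pinv (pinv f) = f"
  by (rule partial_map_eqI) (simp add: pinv_eq_Some_iff assms inj_on_dom_pinv)

lemma inj_on_dom_map_comp:
  assumes "inj_on f (dom f)" "inj_on g (dom g)"
  shows "inj_on (f \<circ>\<^sub>m g) (dom (f \<circ>\<^sub>m g))"
  using assms unfolding inj_on_def by (auto simp: map_comp_Some_iff dom_def)

lemma pinv_map_comp:
  assumes "inj_on f (dom f)" "inj_on g (dom g)"
  shows "pinv (f \<circ>\<^sub>m g) = pinv g \<circ>\<^sub>m pinv f"
  by (rule partial_map_eqI)
    (auto simp: pinv_eq_Some_iff assms inj_on_dom_map_comp map_comp_Some_iff)

lemma map_comp_assoc: "(f \<circ>\<^sub>m g) \<circ>\<^sub>m h = f \<circ>\<^sub>m (g \<circ>\<^sub>m h)"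
  by (auto simp: map_comp_def fun_eq_iff split: option.splits)

lemma map_comp_Some_left [simp]: "Some \<circ>\<^sub>m f = f"
  by (auto simp: map_comp_def fun_eq_iff split: option.splits)

lemma map_comp_Some_right [simp]: "f \<circ>\<^sub>m Some = f"
  by (auto simp: map_comp_def)

lemma pinv_Some [simp]: "pinv Some = Some"
  by (rule partial_map_eqI) (auto simp: pinv_eq_Some_iff)

text \<open>Terms outside \<open>dom g\<close> vanish, and \<open>g\<close> is a bijection from
  \<open>dom g\<close> onto \<open>ran g\<close>, so this is a reindexing. It serves both real sums
  (norms) and complex sums (inner products).\<close>

lemma has_sum_pinj_iff:
  fixes \<phi> :: "'b \<Rightarrow> 'c::{comm_monoid_add, topological_space}"
  assumes "inj_on g (dom g)"
  shows "((\<lambda>s. case g s of None \<Rightarrow> 0 | Some t \<Rightarrow> \<phi> t) has_sum a) UNIV \<longleftrightarrow> (\<phi> has_sum a) (ran g)"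
proof -
  have inj: "inj_on (the \<circ> g) (dom g)"
    using assms by (auto simp: inj_on_def dom_def)
  have "((\<lambda>s. case g s of None \<Rightarrow> 0 | Some t \<Rightarrow> \<phi> t) has_sum a) UNIV
      \<longleftrightarrow> (\<phi> \<circ> (the \<circ> g) has_sum a) (dom g)"
    by (rule has_sum_cong_neutral) (auto split: option.splits)
  also have "\<dots> \<longleftrightarrow> (\<phi> has_sum a) ((the \<circ> g) ` dom g)"
    by (rule has_sum_reindex[OF inj, symmetric])
  also have "(the \<circ> g) ` dom g = ran g"
    by (force simp: ran_def dom_def image_iff)
  finally show ?thesis .
qed


section \<open>The action of partial injections on square-summable functions\<close>

lemma cinner_ell2_ket_left: "cinner_ell2 (ket t) x = cnj (ell2_fun x t)"
proof -
  have "(\<Sum>\<^sub>\<infinity>s. ell2_fun (ket t) s * cnj (ell2_fun x s)) = (\<Sum>\<^sub>\<infinity>s\<in>{t}. cnj (ell2_fun x s))"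
    by (rule infsum_cong_neutral) (auto simp: ket.rep_eq)
  then show ?thesis by (simp add: cinner_ell2.rep_eq)
qed

lemma cinner_ell2_ket_right: "cinner_ell2 x (ket t) = ell2_fun x t"
proof -
  have "(\<Sum>\<^sub>\<infinity>s. ell2_fun x s * cnj (ell2_fun (ket t) s)) = (\<Sum>\<^sub>\<infinity>s\<in>{t}. ell2_fun x s)"
    by (rule infsum_cong_neutral) (auto simp: ket.rep_eq)
  then show ?thesis by (simp add: cinner_ell2.rep_eq)
qed

text \<open>An adjoint is unique because pairing with \<open>ket t\<close> reads off the coordinate
  at \<open>t\<close>, up to conjugation.\<close>

lemma adj_eqI:
  assumes "bounded_clinear_ell2 T'"
    and "\<And>x y. cinner_ell2 (T x) y = cinner_ell2 x (T' y)"
  shows "adj T = T'"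
  unfolding adj_def
proof (rule the_equality)
  fix U assume U: "bounded_clinear_ell2 U \<and> (\<forall>x y. cinner_ell2 (T x) y = cinner_ell2 x (U y))"
  have "cinner_ell2 (ket t) (U y) = cinner_ell2 (ket t) (T' y)" for t y
    using U assms(2) by metis
  then show "U = T'"
    by (simp add: fun_eq_iff ell2_fun_inject[symmetric] cinner_ell2_ket_left)
qed (use assms in simp)

definition pullback :: "('a \<rightharpoonup> 'a) \<Rightarrow> 'a ell2 \<Rightarrow> 'a ell2" where
  "pullback g x = Abs_ell2 (\<lambda>s. case g s of None \<Rightarrow> 0 | Some t \<Rightarrow> ell2_fun x t)"

text \<open>Square-summability, which makes \<open>Abs_ell2\<close> meaningful here, holds because
  an injective \<open>g\<close> uses each coordinate of \<open>x\<close> at most once.\<close>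

lemma ell2_fun_pullback:
  assumes "inj_on g (dom g)"
  shows "ell2_fun (pullback g x) s = (case g s of None \<Rightarrow> 0 | Some t \<Rightarrow> ell2_fun x t)"
proof -
  let ?\<phi> = "\<lambda>t. (cmod (ell2_fun x t))\<^sup>2"
  have "?\<phi> summable_on ran g"
    using ell2_summable by (rule summable_on_subset_banach) simp
  then obtain a where "(?\<phi> has_sum a) (ran g)"
    by (auto simp: summable_on_def)
  then have "((\<lambda>s. case g s of None \<Rightarrow> 0 | Some t \<Rightarrow> ?\<phi> t) has_sum a) UNIV"
    by (simp only: has_sum_pinj_iff[OF assms])
  then have "(\<lambda>s. case g s of None \<Rightarrow> 0 | Some t \<Rightarrow> ?\<phi> t) summable_on UNIV"
    by (rule has_sum_imp_summable)
  \<comment> \<open>The default 0 lets squaring the modulus pass through the case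
    distinction.\<close>
  also have "(\<lambda>s. case g s of None \<Rightarrow> 0 | Some t \<Rightarrow> ?\<phi> t)
      = (\<lambda>s. (cmod (case g s of None \<Rightarrow> 0 | Some t \<Rightarrow> ell2_fun x t))\<^sup>2)"
    by (auto simp: fun_eq_iff split: option.splits)
  finally show ?thesis
    by (simp add: pullback_def Abs_ell2_inverse)
qed

lemma norm_pullback:
  assumes "inj_on g (dom g)"
  shows "(norm (pullback g x))\<^sup>2 = (\<Sum>\<^sub>\<infinity>t\<in>ran g. (cmod (ell2_fun x t))\<^sup>2)"
proof -
  let ?\<phi> = "\<lambda>t. (cmod (ell2_fun x t))\<^sup>2"
  have "?\<phi> summable_on ran g"
    using ell2_summable by (rule summable_on_subset_banach) simp
  then have "((\<lambda>s. case g s of None \<Rightarrow> 0 | Some t \<Rightarrow> ?\<phi> t) has_sum infsum ?\<phi> (ran g)) UNIV"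
    by (simp add: has_sum_pinj_iff[OF assms])
  moreover have "(\<lambda>s. case g s of None \<Rightarrow> 0 | Some t \<Rightarrow> ?\<phi> t)
      = (\<lambda>s. (cmod (ell2_fun (pullback g x) s))\<^sup>2)"
    by (auto simp: fun_eq_iff ell2_fun_pullback assms split: option.splits)
  ultimately show ?thesis
    unfolding norm_ell2_eq by (simp add: infsumI)
qed

lemma norm_pullback_le:
  assumes "inj_on g (dom g)"
  shows "norm (pullback g x) \<le> norm x"
proof -
  have "(norm (pullback g x))\<^sup>2 \<le> (norm x)\<^sup>2"
    \<comment> \<open>The order matters: \<open>norm_ell2_eq\<close> would also match the norm on
      the left, which must first become a sum over \<open>ran g\<close>.\<close>
    unfolding norm_pullback[OF assms] unfolding norm_ell2_eq
    by (intro infsum_mono2 ell2_summable summable_on_subset_banach[OF ell2_summable]) auto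
  then show ?thesis by simp
qed

lemma bounded_clinear_pullback:
  assumes "inj_on g (dom g)"
  shows "bounded_clinear_ell2 (pullback g)"
proof -
  have add: "pullback g (x + y) = pullback g x + pullback g y" for x y
    by (auto simp: ell2_fun_inject[symmetric] fun_eq_iff ell2_fun_pullback assms plus_ell2.rep_eq
        split: option.splits)
  have sc: "pullback g (scaleC_ell2 c x) = scaleC_ell2 c (pullback g x)" for c x
    by (auto simp: ell2_fun_inject[symmetric] fun_eq_iff ell2_fun_pullback assms
        scaleC_ell2.rep_eq split: option.splits)
  have "bounded_linear (pullback g)"
    by (rule bounded_linear_intro[where K = 1])
      (simp_all add: add sc scaleR_ell2_def norm_pullback_le assms)
  with sc show ?thesis by (simp add: bounded_clinear_ell2_def)
qed

lemma pullback_comp: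
  assumes "inj_on f (dom f)" "inj_on g (dom g)"
  shows "pullback f \<circ> pullback g = pullback (g \<circ>\<^sub>m f)"
proof -
  have "ell2_fun (pullback f (pullback g x)) s = ell2_fun (pullback (g \<circ>\<^sub>m f) x) s" for x s
    unfolding ell2_fun_pullback[OF assms(1)]
      ell2_fun_pullback[OF inj_on_dom_map_comp[OF assms(2,1)]]
    by (simp add: ell2_fun_pullback assms(2) map_comp_def split: option.split)
  then show ?thesis
    by (simp add: fun_eq_iff ell2_fun_inject[symmetric])
qed

lemma pullback_Some [simp]: "pullback Some = id"
  by (simp add: fun_eq_iff ell2_fun_inject[symmetric] ell2_fun_pullback)

lemma pullback_ket:
  assumes "inj_on f (dom f)" "f t = Some r"
  shows "pullback (pinv f) (ket t) = ket r"
proof -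
  \<comment> \<open>By injectivity, \<open>r\<close> is the only point that \<open>pinv f\<close>
    sends to \<open>t\<close>.\<close>
  have r: "pinv f s = Some t \<longleftrightarrow> s = r" for s
    using assms by (auto simp: pinv_eq_Some_iff)
  have "ell2_fun (pullback (pinv f) (ket t)) s = ell2_fun (ket r) s" for s
    using r[of s]
    by (cases "pinv f s") (auto simp: ell2_fun_pullback inj_on_dom_pinv assms ket.rep_eq)
  then show ?thesis
    by (simp add: ell2_fun_inject[symmetric] fun_eq_iff)
qed

text \<open>The matrix of \<open>pullback h\<close> in the basis \<open>ket\<close> has entries 0
  and 1, and the ones mark exactly the graph of \<open>h\<close>.\<close>

lemma pullback_inject:
  assumes "inj_on f (dom f)" "inj_on g (dom g)" "pullback f = pullback g"
  shows "f = g"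
proof (rule partial_map_eqI)
  have "ell2_fun (pullback h (ket t)) s = 1 \<longleftrightarrow> h s = Some t" if "inj_on h (dom h)" for h s t
    using that by (auto simp: ell2_fun_pullback ket.rep_eq split: option.splits)
  then show "f s = Some t \<longleftrightarrow> g s = Some t" for s t
    using assms by metis
qed

text \<open>Both inner products are the same sum of \<open>ell2_fun x t * cnj (ell2_fun y s)\<close>
  over the graph of \<open>g\<close>, indexed once by \<open>s\<close> in \<open>dom g\<close> and
  once by \<open>t\<close> in \<open>ran g\<close>.\<close>

lemma adj_pullback:
  assumes g: "inj_on g (dom g)"
  shows "adj (pullback g) = pullback (pinv g)"
proof (rule adj_eqI)
  show "bounded_clinear_ell2 (pullback (pinv g))"
    by (intro bounded_clinear_pullback inj_on_dom_pinv g)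
  fix x y
  let ?\<phi> = "\<lambda>t. ell2_fun x t * cnj (ell2_fun (pullback (pinv g) y) t)"
  have \<phi>: "?\<phi> summable_on UNIV"
    by (intro summable_mult_cnj ell2_summable)
  have supp: "ell2_fun (pullback (pinv g) y) t = 0" if "t \<notin> ran g" for t
  proof -
    have "pinv g t = None" using that by (simp add: pinv_def)
    then show ?thesis by (simp add: ell2_fun_pullback inj_on_dom_pinv g)
  qed
  have "(?\<phi> has_sum cinner_ell2 x (pullback (pinv g) y)) UNIV"
    unfolding cinner_ell2.rep_eq using \<phi> by (rule has_sum_infsum)
  then have "(?\<phi> has_sum cinner_ell2 x (pullback (pinv g) y)) (ran g)"
    by (rule has_sum_cong_neutral[THEN iffD1, rotated -1]) (auto simp: supp)
  then have "((\<lambda>s. case g s of None \<Rightarrow> 0 | Some t \<Rightarrow> ?\<phi> t)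
      has_sum cinner_ell2 x (pullback (pinv g) y)) UNIV"
    by (simp only: has_sum_pinj_iff[OF g])
  moreover have "(case g s of None \<Rightarrow> 0 | Some t \<Rightarrow> ?\<phi> t)
      = ell2_fun (pullback g x) s * cnj (ell2_fun y s)" for s
  proof (cases "g s")
    case None
    then show ?thesis by (simp add: ell2_fun_pullback g)
  next
    case (Some t)
    then have "pinv g t = Some s" by (simp add: pinv_eq_Some_iff g)
    with Some show ?thesis by (simp add: ell2_fun_pullback g inj_on_dom_pinv)
  qed
  ultimately show "cinner_ell2 (pullback g x) y = cinner_ell2 x (pullback (pinv g) y)"
    by (simp add: cinner_ell2.rep_eq[of "pullback g x"] infsumI)
qed

text \<open>The kernel contains \<open>ket t\<close> for every \<open>t\<close> outside
  \<open>ran g\<close>. A vector orthogonal to the kernel is therefore supported on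
  \<open>ran g\<close>, and \<open>pullback g\<close> preserves the norm of such vectors.\<close>

lemma partial_isometry_pullback:
  assumes g: "inj_on g (dom g)"
  shows "partial_isometry (pullback g)"
  unfolding partial_isometry_def
proof (intro conjI allI impI bounded_clinear_pullback[OF g])
  fix x assume x: "\<forall>y. pullback g y = 0 \<longrightarrow> cinner_ell2 x y = 0"
  have "ell2_fun x t = 0" if t: "t \<notin> ran g" for t
  proof -
    have "ell2_fun (pullback g (ket t)) s = 0" for s
      using t by (auto simp: ell2_fun_pullback g ket.rep_eq ran_def split: option.splits)
    then have "pullback g (ket t) = 0"
      by (simp add: ell2_fun_inject[symmetric] fun_eq_iff zero_ell2.rep_eq)
    with x show ?thesis by (simp flip: cinner_ell2_ket_right)
  qed
  then have "(norm (pullback g x))\<^sup>2 = (norm x)\<^sup>2"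
    unfolding norm_pullback[OF g] unfolding norm_ell2_eq
    by (intro infsum_cong_neutral) auto
  then show "norm (pullback g x) = norm x" by simp
qed


section \<open>The left inverse hull of a left cancellative monoid\<close>

context
  assumes left_cancel: "\<And>s r t :: 'a::monoid_mult. s * r = s * t \<Longrightarrow> r = t"
begin

lemma inj_left_mult: "inj_on (left_mult (s :: 'a)) (dom (left_mult s))"
  by (auto simp: inj_on_def left_mult_def dest: left_cancel)

lemma left_inverse_hull_inj:
  "f \<in> left_inverse_hull \<Longrightarrow> inj_on f (dom (f :: 'a \<rightharpoonup> 'a))"
  by (induction rule: left_inverse_hull.induct)
    (rule inj_left_mult inj_on_dom_map_comp inj_on_dom_pinv; assumption?)+

lemma V_eq_pullback: "V s = pullback (pinv (left_mult (s :: 'a)))"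
  unfolding V_def
proof (rule the1_equality[OF V_unique_existence[OF left_cancel]])
  show "bounded_clinear_ell2 (pullback (pinv (left_mult s))) \<and>
      (\<forall>t. pullback (pinv (left_mult s)) (ket t) = ket (s * t))"
    by (simp add: bounded_clinear_pullback inj_on_dom_pinv inj_left_mult
        pullback_ket[OF inj_left_mult] left_mult_def[THEN fun_cong])
qed

text \<open>The counterpart of \<open>V_words\<close> for partial maps. The empty word is allowed,
  with the identity as its value, so that inductions can start there.\<close>

definition word_map :: "('a \<times> 'a) list \<Rightarrow> ('a \<rightharpoonup> 'a)" where
  "word_map w = foldr (\<lambda>(t, s) f. pinv (left_mult t) \<circ>\<^sub>m left_mult s \<circ>\<^sub>m f) w Some"

lemma word_map_Nil [simp]: "word_map [] = Some"
  and word_map_Cons [simp]: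
    "word_map ((t, s) # w) = pinv (left_mult t) \<circ>\<^sub>m left_mult s \<circ>\<^sub>m word_map w"
  by (simp_all add: word_map_def)

lemma word_map_append: "word_map (v @ w) = word_map v \<circ>\<^sub>m word_map w"
  by (induction v) (auto simp: map_comp_assoc)

lemma inj_word_map: "inj_on (word_map w) (dom (word_map w))"
  by (induction w) (auto intro!: inj_on_dom_map_comp inj_on_dom_pinv inj_left_mult)

text \<open>Inversion reverses a product, and the inverse of
  \<open>pinv (left_mult t) \<circ>\<^sub>m left_mult s\<close> is the letter with \<open>s\<close>
  and \<open>t\<close> exchanged.\<close>

lemma pinv_word_map: "pinv (word_map w) = word_map (rev (map prod.swap w))"
proof (induction w)
  case (Cons p w)
  obtain t s where "p = (t, s)" by (cases p)
  with Cons show ?case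
    by (simp add: word_map_append pinv_map_comp pinv_pinv inj_on_dom_map_comp inj_on_dom_pinv
        inj_left_mult inj_word_map)
qed simp

lemma left_mult_one: "left_mult (1 :: 'a) = Some"
  by (simp add: left_mult_def)

lemma left_inverse_hull_eq: "left_inverse_hull = {word_map w | w. w \<noteq> []}"
proof (intro subset_antisym subsetI)
  fix f :: "'a \<rightharpoonup> 'a" assume "f \<in> left_inverse_hull"
  then show "f \<in> {word_map w | w. w \<noteq> []}"
  proof (induction rule: left_inverse_hull.induct)
    case (gen s)
    have "left_mult s = word_map [(1, s)]" by (simp add: left_mult_one)
    then show ?case by blast
  next
    case (comp f g)
    then show ?case by (auto simp flip: word_map_append)
  next
    case (inv f)
    then obtain w where "f = word_map w" "w \<noteq> []" by blast
    then show ?case using pinv_word_map[of w] by force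
  qed
next
  fix f :: "'a \<rightharpoonup> 'a" assume "f \<in> {word_map w | w. w \<noteq> []}"
  moreover have "word_map w \<in> left_inverse_hull" for w
  proof (induction w)
    \<comment> \<open>The identity lies in the hull as \<open>left_mult 1\<close>.\<close>
    case Nil
    show ?case using left_inverse_hull.gen[of "1 :: 'a"] by (simp add: left_mult_one)
  qed (auto intro!: left_inverse_hull.intros)
  ultimately show "f \<in> left_inverse_hull" by blast
qed

text \<open>Letter by letter, \<open>V s\<close> is the pullback along
  \<open>pinv (left_mult s)\<close> and \<open>adj (V t)\<close> the pullback along
  \<open>left_mult t\<close>. Pullback reverses the order of the factors, and \<open>pinv\<close>
  restores it.\<close>

lemma foldr_V_eq_pullback:
  "foldr (\<lambda>(t, s) A. adj (V t) \<circ> V s \<circ> A) w id = pullback (pinv (word_map w))"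
proof (induction w)
  case (Cons p w)
  obtain t s where "p = (t, s)" by (cases p)
  note inj = inj_left_mult inj_word_map inj_on_dom_pinv inj_on_dom_map_comp
  have "foldr (\<lambda>(t, s) A. adj (V t) \<circ> V s \<circ> A) (p # w) id
      = adj (V t) \<circ> V s \<circ> foldr (\<lambda>(t, s) A. adj (V t) \<circ> V s \<circ> A) w id"
    by (simp add: \<open>p = (t, s)\<close>)
  also have "\<dots> = adj (V t) \<circ> V s \<circ> pullback (pinv (word_map w))"
    by (simp only: Cons.IH)
  also have "\<dots>
      = pullback (left_mult t) \<circ> pullback (pinv (left_mult s)) \<circ> pullback (pinv (word_map w))"
    by (simp only: V_eq_pullback adj_pullback pinv_pinv inj)
  also have "\<dots> = pullback (pinv (word_map w) \<circ>\<^sub>m (pinv (left_mult s) \<circ>\<^sub>m left_mult t))"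
    by (simp only: pullback_comp inj)
  also have "\<dots> = pullback (pinv (word_map (p # w)))"
    by (simp only: \<open>p = (t, s)\<close> word_map_Cons pinv_map_comp pinv_pinv map_comp_assoc inj)
  finally show ?case .
qed simp

lemma V_words_eq: "V_words = (\<lambda>f. pullback (pinv f)) ` (left_inverse_hull :: ('a \<rightharpoonup> 'a) set)"
  unfolding V_words_def left_inverse_hull_eq foldr_V_eq_pullback by blast

end

theorem lemma3p2p2:
  assumes left_cancel: "\<And>s r t :: 'a::monoid_mult. s * r = s * t \<Longrightarrow> r = t"
  shows "\<exists>\<omega> :: ('a \<rightharpoonup> 'a) \<Rightarrow> ('a ell2 \<Rightarrow> 'a ell2).
    \<omega> \<in> hom Il B_ell2 \<and>
    (\<forall>f\<in>carrier Il. partial_isometry (\<omega> f)) \<and>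
    (\<forall>f\<in>carrier Il. \<omega> (pinv f) = adj (\<omega> f)) \<and>
    inj_on \<omega> (carrier Il) \<and>
    (\<forall>s. \<omega> (left_mult s) = V s) \<and>
    \<omega> \<in> iso Il VS"
proof (intro exI conjI ballI allI)
  let ?\<omega> = "\<lambda>f :: 'a \<rightharpoonup> 'a. pullback (pinv f)"
  note inj = left_inverse_hull_inj[OF left_cancel]
  note [simp] = inj inj_on_dom_pinv
  have car [simp]: "carrier Il = (left_inverse_hull :: ('a \<rightharpoonup> 'a) set)"
    by (simp add: Il_def)
  \<comment> \<open>Both \<open>pinv\<close> and \<open>pullback\<close> reverse products, so their
    composite preserves them.\<close>
  have mult: "?\<omega> (f \<circ>\<^sub>m g) = ?\<omega> f \<circ> ?\<omega> g"
    if "f \<in> left_inverse_hull" "g \<in> left_inverse_hull" for f g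
    using that by (simp add: pullback_comp pinv_map_comp)
  show "?\<omega> \<in> hom Il B_ell2"
    by (auto simp: hom_def Il_def operator_monoid_def mult bounded_clinear_pullback)
  show "partial_isometry (?\<omega> f)" if "f \<in> carrier Il" for f
    using that by (simp add: partial_isometry_pullback)
  show "?\<omega> (pinv f) = adj (?\<omega> f)" if "f \<in> carrier Il" for f
    using that by (simp add: adj_pullback)
  show inj_\<omega>: "inj_on ?\<omega> (carrier Il)"
  proof (rule inj_onI)
    fix f g :: "'a \<rightharpoonup> 'a"
    assume fg: "f \<in> carrier Il" "g \<in> carrier Il" and eq: "?\<omega> f = ?\<omega> g"
    \<comment> \<open>The operators determine the inverses; inverting once more recovers
      \<open>f\<close> and \<open>g\<close>.\<close>
    from fg have "pinv f = pinv g" by (intro pullback_inject[OF _ _ eq]) simp_all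
    then have "pinv (pinv f) = pinv (pinv g)" by simp
    with fg show "f = g" by (simp add: pinv_pinv)
  qed
  show "?\<omega> (left_mult s) = V s" for s
    by (rule V_eq_pullback[OF left_cancel, symmetric])
  show "?\<omega> \<in> iso Il VS"
    \<comment> \<open>By \<open>V_words_eq\<close>, the carrier of \<open>VS\<close> is exactly the
      image of the hull, which gives both well-definedness and surjectivity.\<close>
    using inj_\<omega> unfolding iso_def bij_betw_def
    by (auto simp: hom_def Il_def operator_monoid_def mult V_words_eq[OF left_cancel])
qed

end
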